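(* Let $\mathbf k$ be a field and $\Gamma$ a nontrivial ordered abelian group, and let $K=\mathbf k((t^\Gamma))$ be considered as an $L_{\mathcal O,\mathfrak M,\mathcal U}$-structure. Then $K$ interprets the two-sorted structure $(\mathbb N,\mathcal P(\mathbb N);+,\in)$.
   Context: $\mathbf k((t^\Gamma))$ is the Hahn field of series $\sum_\gamma f_\gamma t^\gamma$ ($f_\gamma\in\mathbf k$) with well-ordered support $\operatorname{supp} f=\{\gamma:f_\gamma\neq0\}$. $L_{\mathcal O,\mathfrak M,\mathcal U}=\{0,1,+,\times,\mathcal O,\mathfrak M,\mathcal U\}$ with unary predicates interpreted as: $\mathcal O=\{f:\operatorname{supp}f\subseteq\Gamma^{\ge0}\}$ (the valuation ring), $\mathfrak M=t^\Gamma=\{t^\gamma:\gamma\in\Gamma\}$ (the monomial group), and $\mathcal U=\{f:\operatorname{supp}f\subseteq\Gamma^{<0}\}$. In $(\mathbb N,\mathcal P(\mathbb N);+,\in)$, $+$ is addition on $\mathbb N$ and $\in$ membership between $\mathbb N$ and $\mathcal P(\mathbb N)$. *)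

theory Defs
  imports Complex_Main
begin

section \<open>Well-ordered subsets of ordered abelian groups\<close>

lemma wfp_on_no_strict_dec:
  fixes A :: "'a::linorder set"
  assumes "wfp_on A (<)" and "\<And>n::nat. s n \<in> A" and "\<And>n. s (Suc n) < s n"
  shows False
proof -
  obtain z where z: "z \<in> range s" "\<And>y. y < z \<Longrightarrow> y \<notin> range s"
    using assms(1,2) unfolding wfp_on_iff_ex_minimal
    by (metis UNIV_I empty_is_image empty_not_UNIV image_subset_iff)
  then show False using assms(3) by blast
qed

lemma wfp_on_if_no_strict_dec:
  fixes A :: "'a::linorder set"
  assumes "\<And>s::nat \<Rightarrow> 'a. (\<And>n. s n \<in> A) \<Longrightarrow> (\<And>n. s (Suc n) < s n) \<Longrightarrow> False"
  shows "wfp_on A (<)"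
proof (rule ccontr)
  assume "\<not> wfp_on A (<)"
  then have "\<exists>B\<subseteq>A. B \<noteq> {} \<and> (\<forall>z\<in>B. \<exists>y. y < z \<and> y \<in> B)"
    unfolding wfp_on_iff_ex_minimal by simp
  then obtain B where B: "B \<subseteq> A" "B \<noteq> {}" "\<forall>z\<in>B. \<exists>y. y < z \<and> y \<in> B"
    by (elim exE conjE)
  have "\<exists>s::nat \<Rightarrow> 'a. \<forall>n. s n \<in> B \<and> s (Suc n) < s n"
  proof (rule dependent_nat_choice)
    show "\<exists>x. x \<in> B" using B(2) by (simp add: ex_in_conv)
  next
    fix x n assume "x \<in> B"
    then show "\<exists>y. y \<in> B \<and> y < x" using B(3) by auto
  qed
  then obtain s :: "nat \<Rightarrow> 'a" where "\<forall>n. s n \<in> B \<and> s (Suc n) < s n"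
    by (rule exE)
  then show False using assms[of s] B(1) by (simp add: subset_iff)
qed

lemma wfp_on_mono_subseq:
  fixes A :: "'a::linorder set"
  assumes wf: "wfp_on A (<)" and s: "\<And>n::nat. s n \<in> A"
  obtains r :: "nat \<Rightarrow> nat" where "strict_mono r" "mono (\<lambda>n. s (r n))"
proof -
  obtain r :: "nat \<Rightarrow> nat" where r: "strict_mono r" "monoseq (\<lambda>n. s (r n))"
    using seq_monosub[of s] by blast
  show thesis
  proof (cases "mono (\<lambda>n. s (r n))")
    case True
    then show ?thesis using that r by blast
  next
    case False
    then have dec: "s (r n) \<le> s (r m)" if "m \<le> n" for m n
      using r(2) that unfolding monoseq_def by (auto simp: mono_def)
    obtain N where N: "\<And>n. s (r N) \<le> s (r n)"
    proof -
      obtain z where z: "z \<in> range (\<lambda>n. s (r n))"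
        "\<And>y. y < z \<Longrightarrow> y \<notin> range (\<lambda>n. s (r n))"
        using wf s unfolding wfp_on_iff_ex_minimal
        by (metis UNIV_I empty_is_image empty_not_UNIV image_subset_iff)
      then obtain N where "z = s (r N)" by blast
      then show thesis using that z(2) by (metis linorder_not_less rangeI)
    qed
    have "s (r (n + N)) = s (r N)" for n
      using dec[of N "n + N"] N[of "n + N"] by simp
    then have "mono (\<lambda>n. s (r (n + N)))" by (simp add: mono_def)
    moreover have "strict_mono (\<lambda>n. r (n + N))"
      using r(1) by (simp add: strict_mono_def)
    ultimately show ?thesis using that by blast
  qed
qed

lemma wfp_on_sums:
  fixes A B :: "'a::linordered_ab_group_add set"
  assumes A: "wfp_on A (<)" and B: "wfp_on B (<)"
  shows "wfp_on {a + b |a b. a \<in> A \<and> b \<in> B} (<)"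
proof (rule wfp_on_if_no_strict_dec)
  fix s :: "nat \<Rightarrow> 'a"
  assume s: "\<And>n. s n \<in> {a + b |a b. a \<in> A \<and> b \<in> B}" and dec: "\<And>n. s (Suc n) < s n"
  then have "\<forall>n. \<exists>a b. a \<in> A \<and> b \<in> B \<and> s n = a + b" by blast
  then obtain a b where ab: "\<And>n. a n \<in> A" "\<And>n. b n \<in> B" "\<And>n. s n = a n + b n"
    by metis
  obtain r :: "nat \<Rightarrow> nat" where r: "strict_mono r" "mono (\<lambda>n. a (r n))"
    using wfp_on_mono_subseq[OF A, of a] ab(1) by blast
  have sdec: "s n < s m" if "m < n" for m n
    using that by (induction rule: less_Suc_induct) (auto intro: dec)
  show False
  proof (rule wfp_on_no_strict_dec[OF B, of "\<lambda>n. b (r n)"])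
    fix n
    have "s (r (Suc n)) < s (r n)" using sdec r(1) by (simp add: strict_mono_def)
    moreover have "a (r n) \<le> a (r (Suc n))" using r(2) by (simp add: mono_def)
    ultimately show "b (r (Suc n)) < b (r n)"
      unfolding ab(3) by (metis add_le_less_mono leD leI add_mono)
  qed (use ab in auto)
qed

lemma finite_sum_fibre:
  fixes A B :: "'a::linordered_ab_group_add set"
  assumes A: "wfp_on A (<)" and B: "wfp_on B (<)"
  shows "finite {a. a \<in> A \<and> c - a \<in> B}"
proof (rule ccontr)
  assume "infinite {a. a \<in> A \<and> c - a \<in> B}"
  then obtain s :: "nat \<Rightarrow> 'a" where s: "inj s" "range s \<subseteq> {a. a \<in> A \<and> c - a \<in> B}"
    using infinite_countable_subset by blast
  obtain r :: "nat \<Rightarrow> nat" where r: "strict_mono r" "mono (\<lambda>n. s (r n))"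
    using wfp_on_mono_subseq[OF A, of s] s(2) by blast
  show False
  proof (rule wfp_on_no_strict_dec[OF B, of "\<lambda>n. c - s (r n)"])
    fix n
    have "s (r n) \<le> s (r (Suc n))" using r(2) by (simp add: mono_def)
    moreover have "s (r n) \<noteq> s (r (Suc n))"
      using s(1) r(1) by (metis inj_eq n_not_Suc_n strict_mono_eq)
    ultimately show "c - s (r (Suc n)) < c - s (r n)" by simp
  qed (use s in auto)
qed

section \<open>The Hahn field\<close>

typedef (overloaded) ('k::zero, 'g::linorder) hahn =
  "{f :: 'g \<Rightarrow> 'k. wfp_on {\<gamma>. f \<gamma> \<noteq> 0} (<)}"
  morphisms hahn_coeff Abs_hahn
proof
  show "(\<lambda>_. 0) \<in> {f :: 'g \<Rightarrow> 'k. wfp_on {\<gamma>. f \<gamma> \<noteq> 0} (<)}"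
    by (simp add: wfp_on_def)
qed

setup_lifting type_definition_hahn

definition hahn_supp :: "('k::zero, 'g::linorder) hahn \<Rightarrow> 'g set" where
  "hahn_supp f = {\<gamma>. hahn_coeff f \<gamma> \<noteq> 0}"

lemma wfp_on_hahn_supp: "wfp_on (hahn_supp f) (<)"
  using hahn_coeff[of f] by (simp add: hahn_supp_def)

lemma hahn_eqI: "(\<And>\<gamma>. hahn_coeff f \<gamma> = hahn_coeff g \<gamma>) \<Longrightarrow> f = g"
  by (metis hahn_coeff_inject ext)

lift_definition hahn_monom :: "'g::linorder \<Rightarrow> ('k::zero_neq_one, 'g) hahn"
  is "\<lambda>\<gamma> \<delta>. if \<delta> = \<gamma> then 1 else 0"
  by (simp add: wfp_on_def)

lemma wfp_on_union:
  fixes A B :: "'a::linorder set"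
  assumes A: "wfp_on A (<)" and B: "wfp_on B (<)"
  shows "wfp_on (A \<union> B) (<)"
  unfolding wfp_on_iff_ex_minimal
proof (intro allI impI)
  fix C assume C: "C \<subseteq> A \<union> B" "C \<noteq> {}"
  have least: "\<exists>z\<in>C \<inter> D. \<forall>y\<in>C \<inter> D. z \<le> y" if D: "wfp_on D (<)" "C \<inter> D \<noteq> {}" for D
  proof -
    obtain z where "z \<in> C \<inter> D" "\<forall>y. y < z \<longrightarrow> y \<notin> C \<inter> D"
      using D(1)[unfolded wfp_on_iff_ex_minimal, rule_format, OF Int_lower2 D(2)] by auto
    then show ?thesis using leI by blast
  qed
  have "\<exists>z\<in>C. \<forall>y\<in>C. z \<le> y"
  proof (cases "C \<inter> A = {} \<or> C \<inter> B = {}")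
    case True
    then have "C \<inter> A = C \<or> C \<inter> B = C" using C(1) by auto
    then show ?thesis
    proof
      assume "C \<inter> A = C"
      then show ?thesis using least[OF A] C(2) by simp
    next
      assume "C \<inter> B = C"
      then show ?thesis using least[OF B] C(2) by simp
    qed
  next
    case False
    then obtain x y where x: "x \<in> C \<inter> A" "\<forall>z\<in>C \<inter> A. x \<le> z"
      and y: "y \<in> C \<inter> B" "\<forall>z\<in>C \<inter> B. y \<le> z" using least[OF A] least[OF B] by auto
    have "min x y \<in> C" using x(1) y(1) by (simp add: min_def)
    moreover have "min x y \<le> z" if "z \<in> C" for z
      using that C(1) x(2) y(2) by (auto simp: min_le_iff_disj)
    ultimately show ?thesis by blast
  qed
  then show "\<exists>z\<in>C. \<forall>y. y < z \<longrightarrow> y \<notin> C" by (meson leD)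
qed

instantiation hahn :: (comm_ring_1, linordered_ab_group_add) comm_ring_1
begin

lift_definition zero_hahn :: "('a, 'b) hahn" is "\<lambda>_. 0"
  by (simp add: wfp_on_def)

definition one_hahn :: "('a, 'b) hahn" where
  "one_hahn = hahn_monom 0"

lift_definition plus_hahn :: "('a, 'b) hahn \<Rightarrow> ('a, 'b) hahn \<Rightarrow> ('a, 'b) hahn"
  is "\<lambda>f g \<gamma>. f \<gamma> + g \<gamma>"
  by (erule (1) wfp_on_subset[OF wfp_on_union]) auto

lift_definition uminus_hahn :: "('a, 'b) hahn \<Rightarrow> ('a, 'b) hahn"
  is "\<lambda>f \<gamma>. - f \<gamma>"
  by simp

definition minus_hahn :: "('a, 'b) hahn \<Rightarrow> ('a, 'b) hahn \<Rightarrow> ('a, 'b) hahn" where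
  "minus_hahn f g = f + - g"

text \<open>The index set of the sum is finite by \<open>finite_sum_fibre\<close>.\<close>

lift_definition times_hahn :: "('a, 'b) hahn \<Rightarrow> ('a, 'b) hahn \<Rightarrow> ('a, 'b) hahn"
  is "\<lambda>f g \<gamma>. \<Sum>\<alpha> | f \<alpha> \<noteq> 0 \<and> g (\<gamma> - \<alpha>) \<noteq> 0. f \<alpha> * g (\<gamma> - \<alpha>)"
proof -
  fix f g :: "'b \<Rightarrow> 'a"
  assume "wfp_on {\<gamma>. f \<gamma> \<noteq> 0} (<)" "wfp_on {\<gamma>. g \<gamma> \<noteq> 0} (<)"
  note wf = wfp_on_sums[OF this]
  show "wfp_on {\<gamma>. (\<Sum>\<alpha> | f \<alpha> \<noteq> 0 \<and> g (\<gamma> - \<alpha>) \<noteq> 0. f \<alpha> * g (\<gamma> - \<alpha>)) \<noteq> 0} (<)"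
  proof (rule wfp_on_subset[OF wf], rule subsetI)
    fix \<gamma> assume \<gamma>: "\<gamma> \<in> {\<gamma>. (\<Sum>\<alpha> | f \<alpha> \<noteq> 0 \<and> g (\<gamma> - \<alpha>) \<noteq> 0. f \<alpha> * g (\<gamma> - \<alpha>)) \<noteq> 0}"
    have "{\<alpha>. f \<alpha> \<noteq> 0 \<and> g (\<gamma> - \<alpha>) \<noteq> 0} \<noteq> {}"
    proof
      assume "{\<alpha>. f \<alpha> \<noteq> 0 \<and> g (\<gamma> - \<alpha>) \<noteq> 0} = {}"
      then show False using \<gamma> by (simp only: sum.empty mem_Collect_eq simp_thms)
    qed
    then obtain \<alpha> where "f \<alpha> \<noteq> 0" "g (\<gamma> - \<alpha>) \<noteq> 0" by blast
    moreover have "\<gamma> = \<alpha> + (\<gamma> - \<alpha>)" by simp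
    ultimately show "\<gamma> \<in> {a + b |a b. a \<in> {\<gamma>. f \<gamma> \<noteq> 0} \<and> b \<in> {\<gamma>. g \<gamma> \<noteq> 0}}"
      by blast
  qed
qed

lemma finite_times_fibre:
  "finite {\<alpha>. hahn_coeff (f :: ('a, 'b) hahn) \<alpha> \<noteq> 0 \<and> hahn_coeff (g :: ('a, 'b) hahn) (\<gamma> - \<alpha>) \<noteq> 0}"
  using finite_sum_fibre[OF wfp_on_hahn_supp[of f] wfp_on_hahn_supp[of g]]
  by (simp add: hahn_supp_def)

lemma coeff_times_superset:
  fixes f g :: "('a, 'b) hahn"
  assumes "finite S" "{\<alpha>. hahn_coeff f \<alpha> \<noteq> 0 \<and> hahn_coeff g (\<gamma> - \<alpha>) \<noteq> 0} \<subseteq> S"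
  shows "hahn_coeff (f * g) \<gamma> = (\<Sum>\<alpha>\<in>S. hahn_coeff f \<alpha> * hahn_coeff g (\<gamma> - \<alpha>))"
  unfolding times_hahn.rep_eq
  by (rule sum.mono_neutral_left) (use assms in auto)

instance
proof
  fix f g h :: "('a, 'b) hahn"
  show comm: "f * g = g * f" for f g :: "('a, 'b) hahn"
  proof (rule hahn_eqI)
    fix \<gamma>
    show "hahn_coeff (f * g) \<gamma> = hahn_coeff (g * f) \<gamma>"
      unfolding times_hahn.rep_eq
      by (rule sum.reindex_bij_witness[of _ "\<lambda>\<alpha>. \<gamma> - \<alpha>" "\<lambda>\<alpha>. \<gamma> - \<alpha>"])
        (auto simp: mult.commute)
  qed
  show "1 * f = f"
  proof (rule hahn_eqI)
    fix \<gamma>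
    have "hahn_coeff (1 * f) \<gamma> = (\<Sum>\<alpha>\<in>{0}. hahn_coeff 1 \<alpha> * hahn_coeff f (\<gamma> - \<alpha>))"
      by (rule coeff_times_superset) (auto simp: one_hahn_def hahn_monom.rep_eq split: if_splits)
    then show "hahn_coeff (1 * f) \<gamma> = hahn_coeff f \<gamma>"
      by (simp add: one_hahn_def hahn_monom.rep_eq)
  qed
  show "(f + g) * h = f * h + g * h"
  proof (rule hahn_eqI)
    fix \<gamma>
    define S where "S = {\<alpha>. hahn_coeff f \<alpha> \<noteq> 0 \<and> hahn_coeff h (\<gamma> - \<alpha>) \<noteq> 0} \<union>
      {\<alpha>. hahn_coeff g \<alpha> \<noteq> 0 \<and> hahn_coeff h (\<gamma> - \<alpha>) \<noteq> 0}"
    have S: "finite S" unfolding S_def by (simp add: finite_times_fibre)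
    have "hahn_coeff ((f + g) * h) \<gamma> = (\<Sum>\<alpha>\<in>S. hahn_coeff (f + g) \<alpha> * hahn_coeff h (\<gamma> - \<alpha>))"
      by (rule coeff_times_superset[OF S]) (auto simp: S_def plus_hahn.rep_eq)
    moreover have "hahn_coeff (f * h) \<gamma> = (\<Sum>\<alpha>\<in>S. hahn_coeff f \<alpha> * hahn_coeff h (\<gamma> - \<alpha>))"
      by (rule coeff_times_superset[OF S]) (auto simp: S_def)
    moreover have "hahn_coeff (g * h) \<gamma> = (\<Sum>\<alpha>\<in>S. hahn_coeff g \<alpha> * hahn_coeff h (\<gamma> - \<alpha>))"
      by (rule coeff_times_superset[OF S]) (auto simp: S_def)
    ultimately show "hahn_coeff ((f + g) * h) \<gamma> = hahn_coeff (f * h + g * h) \<gamma>"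
      by (simp add: plus_hahn.rep_eq distrib_right sum.distrib)
  qed
  show "f * g * h = f * (g * h)"
  proof (rule hahn_eqI)
    fix \<gamma>
    let ?f = "hahn_coeff f" and ?g = "hahn_coeff g" and ?h = "hahn_coeff h"
    define fg where "fg = {a + b |a b. a \<in> hahn_supp f \<and> b \<in> hahn_supp g}"
    define gh where "gh = {a + b |a b. a \<in> hahn_supp g \<and> b \<in> hahn_supp h}"
    define S where "S = {\<sigma>. \<sigma> \<in> fg \<and> \<gamma> - \<sigma> \<in> hahn_supp h}"
    define T where "T = {\<alpha>. \<alpha> \<in> hahn_supp f \<and> \<gamma> - \<alpha> \<in> gh}"
    have S: "finite S" unfolding S_def fg_def
      by (intro finite_sum_fibre wfp_on_sums wfp_on_hahn_supp)
    have T: "finite T" unfolding T_def gh_def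
      by (intro finite_sum_fibre wfp_on_sums wfp_on_hahn_supp)
    have fg: "hahn_coeff (f * g) \<sigma> \<noteq> 0 \<Longrightarrow> \<sigma> \<in> fg" for \<sigma>
    proof -
      assume "hahn_coeff (f * g) \<sigma> \<noteq> 0"
      then obtain \<alpha> where "?f \<alpha> \<noteq> 0" "?g (\<sigma> - \<alpha>) \<noteq> 0"
        unfolding times_hahn.rep_eq by (metis (mono_tags, lifting) mem_Collect_eq sum.neutral)
      moreover have "\<sigma> = \<alpha> + (\<sigma> - \<alpha>)" by simp
      ultimately show "\<sigma> \<in> fg" unfolding fg_def hahn_supp_def by blast
    qed
    have gh: "hahn_coeff (g * h) \<sigma> \<noteq> 0 \<Longrightarrow> \<sigma> \<in> gh" for \<sigma>
    proof -
      assume "hahn_coeff (g * h) \<sigma> \<noteq> 0"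
      then obtain \<alpha> where "?g \<alpha> \<noteq> 0" "?h (\<sigma> - \<alpha>) \<noteq> 0"
        unfolding times_hahn.rep_eq by (metis (mono_tags, lifting) mem_Collect_eq sum.neutral)
      moreover have "\<sigma> = \<alpha> + (\<sigma> - \<alpha>)" by simp
      ultimately show "\<sigma> \<in> gh" unfolding gh_def hahn_supp_def by blast
    qed
    have "hahn_coeff (f * g * h) \<gamma> = (\<Sum>\<sigma>\<in>S. hahn_coeff (f * g) \<sigma> * ?h (\<gamma> - \<sigma>))"
      by (rule coeff_times_superset[OF S]) (use fg in \<open>auto simp: S_def hahn_supp_def\<close>)
    also have "\<dots> = (\<Sum>\<sigma>\<in>S. \<Sum>\<alpha> | ?f \<alpha> \<noteq> 0 \<and> ?g (\<sigma> - \<alpha>) \<noteq> 0. ?f \<alpha> * ?g (\<sigma> - \<alpha>) * ?h (\<gamma> - \<sigma>))"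
      by (simp add: times_hahn.rep_eq sum_distrib_right)
    also have "\<dots> = (\<Sum>(\<sigma>, \<alpha>)\<in>(SIGMA \<sigma>:S. {\<alpha>. ?f \<alpha> \<noteq> 0 \<and> ?g (\<sigma> - \<alpha>) \<noteq> 0}).
        ?f \<alpha> * ?g (\<sigma> - \<alpha>) * ?h (\<gamma> - \<sigma>))"
      by (rule sum.Sigma) (simp_all add: S finite_times_fibre)
    also have "\<dots> = (\<Sum>(\<alpha>, \<beta>)\<in>(SIGMA \<alpha>:T. {\<beta>. ?g \<beta> \<noteq> 0 \<and> ?h (\<gamma> - \<alpha> - \<beta>) \<noteq> 0}).
        ?f \<alpha> * (?g \<beta> * ?h (\<gamma> - \<alpha> - \<beta>)))"
    proof (rule sum.reindex_bij_witness[of _ "\<lambda>(\<alpha>, \<beta>). (\<alpha> + \<beta>, \<alpha>)" "\<lambda>(\<sigma>, \<alpha>). (\<alpha>, \<sigma> - \<alpha>)"], goal_cases)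
      case (2 p)
      then obtain \<sigma> \<alpha> where p: "p = (\<sigma>, \<alpha>)" "\<sigma> \<in> S" "?f \<alpha> \<noteq> 0" "?g (\<sigma> - \<alpha>) \<noteq> 0" by auto
      have "\<gamma> - \<alpha> = (\<sigma> - \<alpha>) + (\<gamma> - \<sigma>)" by simp
      then have "\<gamma> - \<alpha> \<in> gh" using p unfolding gh_def S_def hahn_supp_def by blast
      then show ?case using p by (auto simp: T_def S_def hahn_supp_def)
    next
      case (4 p)
      then obtain \<alpha> \<beta> where p: "p = (\<alpha>, \<beta>)" "\<alpha> \<in> T" "?g \<beta> \<noteq> 0" "?h (\<gamma> - \<alpha> - \<beta>) \<noteq> 0" by auto
      have "\<alpha> + \<beta> \<in> fg" using p unfolding fg_def T_def hahn_supp_def by blast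
      then show ?case using p by (auto simp: T_def S_def hahn_supp_def diff_diff_eq)
    qed (auto simp: mult.assoc diff_diff_eq)
    also have "\<dots> = (\<Sum>\<alpha>\<in>T. \<Sum>\<beta> | ?g \<beta> \<noteq> 0 \<and> ?h (\<gamma> - \<alpha> - \<beta>) \<noteq> 0. ?f \<alpha> * (?g \<beta> * ?h (\<gamma> - \<alpha> - \<beta>)))"
      by (rule sum.Sigma[symmetric]) (simp_all add: T finite_times_fibre)
    also have "\<dots> = (\<Sum>\<alpha>\<in>T. ?f \<alpha> * hahn_coeff (g * h) (\<gamma> - \<alpha>))"
      by (simp add: times_hahn.rep_eq sum_distrib_left)
    also have "\<dots> = hahn_coeff (f * (g * h)) \<gamma>"
      by (rule coeff_times_superset[OF T, symmetric]) (use gh in \<open>auto simp: T_def hahn_supp_def\<close>)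
    finally show "hahn_coeff (f * g * h) \<gamma> = hahn_coeff (f * (g * h)) \<gamma>" .
  qed
  show "(0 :: ('a, 'b) hahn) \<noteq> 1"
  proof
    assume "(0 :: ('a, 'b) hahn) = 1"
    then have "hahn_coeff (0 :: ('a, 'b) hahn) 0 = hahn_coeff 1 0" by simp
    then show False by (simp add: one_hahn_def hahn_monom.rep_eq zero_hahn.rep_eq)
  qed
  show "f + g + h = f + (g + h)"
    by (rule hahn_eqI) (simp add: plus_hahn.rep_eq add.assoc)
  show "f + g = g + f"
    by (rule hahn_eqI) (simp add: plus_hahn.rep_eq add.commute)
  show "0 + f = f"
    by (rule hahn_eqI) (simp add: plus_hahn.rep_eq zero_hahn.rep_eq)
  show "- f + f = 0"
    by (rule hahn_eqI) (simp add: plus_hahn.rep_eq uminus_hahn.rep_eq zero_hahn.rep_eq)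
  show "f - g = f + - g"
    by (fact minus_hahn_def)
qed

end

section \<open>First-order structures, definability and interpretations\<close>

datatype 'f fo_term = Var nat | Fn 'f "'f fo_term list"

text \<open>Bound variables are de Bruijn indices.\<close>

datatype ('f, 'r) fo_form =
    Eq "'f fo_term" "'f fo_term"
  | Rel 'r "'f fo_term list"
  | Neg "('f, 'r) fo_form"
  | And "('f, 'r) fo_form" "('f, 'r) fo_form"
  | Ex "('f, 'r) fo_form"

record ('f, 'r, 'a) fo_struct =
  univ :: "'a set"
  fun_ar :: "'f \<Rightarrow> nat"
  fun_int :: "'f \<Rightarrow> 'a list \<Rightarrow> 'a"
  rel_ar :: "'r \<Rightarrow> nat"
  rel_int :: "'r \<Rightarrow> 'a list \<Rightarrow> bool"

primrec wf_term :: "('f, 'r, 'a) fo_struct \<Rightarrow> 'f fo_term \<Rightarrow> bool" where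
  "wf_term M (Var i) \<longleftrightarrow> True"
| "wf_term M (Fn f ts) \<longleftrightarrow> length ts = fun_ar M f \<and> list_all (\<lambda>b. b) (map (wf_term M) ts)"

primrec wf_form :: "('f, 'r, 'a) fo_struct \<Rightarrow> ('f, 'r) fo_form \<Rightarrow> bool" where
  "wf_form M (Eq s t) \<longleftrightarrow> wf_term M s \<and> wf_term M t"
| "wf_form M (Rel r ts) \<longleftrightarrow> length ts = rel_ar M r \<and> list_all (wf_term M) ts"
| "wf_form M (Neg \<phi>) \<longleftrightarrow> wf_form M \<phi>"
| "wf_form M (And \<phi> \<psi>) \<longleftrightarrow> wf_form M \<phi> \<and> wf_form M \<psi>"
| "wf_form M (Ex \<phi>) \<longleftrightarrow> wf_form M \<phi>"

primrec eval :: "('f, 'r, 'a) fo_struct \<Rightarrow> (nat \<Rightarrow> 'a) \<Rightarrow> 'f fo_term \<Rightarrow> 'a" where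
  "eval M e (Var i) = e i"
| "eval M e (Fn f ts) = fun_int M f (map (eval M e) ts)"

primrec sat :: "('f, 'r, 'a) fo_struct \<Rightarrow> (nat \<Rightarrow> 'a) \<Rightarrow> ('f, 'r) fo_form \<Rightarrow> bool" where
  "sat M e (Eq s t) \<longleftrightarrow> eval M e s = eval M e t"
| "sat M e (Rel r ts) \<longleftrightarrow> rel_int M r (map (eval M e) ts)"
| "sat M e (Neg \<phi>) \<longleftrightarrow> \<not> sat M e \<phi>"
| "sat M e (And \<phi> \<psi>) \<longleftrightarrow> sat M e \<phi> \<and> sat M e \<psi>"
| "sat M e (Ex \<phi>) \<longleftrightarrow> (\<exists>a\<in>univ M. sat M (case_nat a e) \<phi>)"

text \<open>
  Definability with parameters of a subset of \<open>univ M\<close> to the \<open>n\<close>: variables \<open>0, \<dots>, n - 1\<close>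
  stand for the coordinates, and variable \<open>n + j\<close> for the parameter \<open>p j\<close>.  Only finitely many
  parameters matter, since a formula has finitely many variables.
\<close>

definition definable :: "('f, 'r, 'a) fo_struct \<Rightarrow> nat \<Rightarrow> 'a list set \<Rightarrow> bool" where
  "definable M n X \<longleftrightarrow>
    (\<exists>\<phi> p. wf_form M \<phi> \<and> range p \<subseteq> univ M \<and>
      X = {xs. length xs = n \<and> set xs \<subseteq> univ M \<and>
               sat M (\<lambda>i. if i < n then xs ! i else p (i - n)) \<phi>})"

text \<open>Many-sorted structures; a function symbol has a list of argument sorts and a result sort.\<close>

record ('s, 'f, 'r, 'b) ms_struct =
  ms_univ :: "'s \<Rightarrow> 'b set"
  ms_fun_ar :: "'f \<Rightarrow> 's list \<times> 's"
  ms_fun_int :: "'f \<Rightarrow> 'b list \<Rightarrow> 'b"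
  ms_rel_ar :: "'r \<Rightarrow> 's list"
  ms_rel_int :: "'r \<Rightarrow> 'b list \<Rightarrow> bool"

text \<open>
  An interpretation consists of coordinate maps \<open>\<pi> s\<close> from a definable set \<open>D s\<close> of
  \<open>d s\<close>-tuples onto each sort \<open>s\<close>, such that the preimages of equality on each sort, of
  the relations and of the graphs of the functions are definable.  A tuple of tuples is
  identified with its concatenation.
\<close>

definition coord_preimage ::
  "('s \<Rightarrow> 'a list set) \<Rightarrow> ('s \<Rightarrow> 'a list \<Rightarrow> 'b) \<Rightarrow> 's list \<Rightarrow> ('b list \<Rightarrow> bool) \<Rightarrow> 'a list set" where
  "coord_preimage D \<pi> ss R =
    {concat xss |xss. list_all2 (\<lambda>s xs. xs \<in> D s) ss xss \<and> R (map2 \<pi> ss xss)}"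

definition is_interpretation ::
  "('f, 'r, 'a) fo_struct \<Rightarrow> ('s, 'g, 'q, 'b) ms_struct \<Rightarrow>
    ('s \<Rightarrow> nat) \<Rightarrow> ('s \<Rightarrow> 'a list set) \<Rightarrow> ('s \<Rightarrow> 'a list \<Rightarrow> 'b) \<Rightarrow> bool" where
  "is_interpretation M N d D \<pi> \<longleftrightarrow>
    (\<forall>s. definable M (d s) (D s) \<and> \<pi> s ` D s = ms_univ N s) \<and>
    (\<forall>s. definable M (d s + d s) (coord_preimage D \<pi> [s, s] (\<lambda>bs. bs ! 0 = bs ! 1))) \<and>
    (\<forall>q. definable M (sum_list (map d (ms_rel_ar N q)))
           (coord_preimage D \<pi> (ms_rel_ar N q) (ms_rel_int N q))) \<and>
    (\<forall>g ss s. ms_fun_ar N g = (ss, s) \<longrightarrow>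
       definable M (sum_list (map d ss) + d s)
         (coord_preimage D \<pi> (ss @ [s]) (\<lambda>bs. ms_fun_int N g (butlast bs) = last bs)))"

definition interprets :: "('f, 'r, 'a) fo_struct \<Rightarrow> ('s, 'g, 'q, 'b) ms_struct \<Rightarrow> bool" where
  "interprets M N \<longleftrightarrow> (\<exists>d D \<pi>. is_interpretation M N d D \<pi>)"

section \<open>The two structures\<close>

datatype hahn_fun = Zero_sym | One_sym | Plus_sym | Times_sym
datatype hahn_rel = O_sym | M_sym | U_sym

primrec hahn_fun_ar :: "hahn_fun \<Rightarrow> nat" where
  "hahn_fun_ar Zero_sym = 0"
| "hahn_fun_ar One_sym = 0"
| "hahn_fun_ar Plus_sym = 2"
| "hahn_fun_ar Times_sym = 2"

primrec hahn_fun_int ::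
  "hahn_fun \<Rightarrow> ('k::field, 'g::linordered_ab_group_add) hahn list \<Rightarrow> ('k, 'g) hahn" where
  "hahn_fun_int Zero_sym xs = 0"
| "hahn_fun_int One_sym xs = 1"
| "hahn_fun_int Plus_sym xs = xs ! 0 + xs ! 1"
| "hahn_fun_int Times_sym xs = xs ! 0 * xs ! 1"

primrec hahn_rel_int ::
  "hahn_rel \<Rightarrow> ('k::field, 'g::linordered_ab_group_add) hahn list \<Rightarrow> bool" where
  "hahn_rel_int O_sym xs \<longleftrightarrow> hahn_supp (xs ! 0) \<subseteq> {0..}"
| "hahn_rel_int M_sym xs \<longleftrightarrow> xs ! 0 \<in> range hahn_monom"
| "hahn_rel_int U_sym xs \<longleftrightarrow> hahn_supp (xs ! 0) \<subseteq> {..<0}"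

definition hahn_struct ::
  "(hahn_fun, hahn_rel, ('k::field, 'g::linordered_ab_group_add) hahn) fo_struct" where
  "hahn_struct =
    \<lparr>univ = UNIV, fun_ar = hahn_fun_ar, fun_int = hahn_fun_int,
     rel_ar = (\<lambda>_. 1), rel_int = hahn_rel_int\<rparr>"

datatype nat_sort = Num_sort | Set_sort
datatype nat_fun = Add_sym
datatype nat_rel = Mem_sym

primrec nat_sort_univ :: "nat_sort \<Rightarrow> (nat + nat set) set" where
  "nat_sort_univ Num_sort = range Inl"
| "nat_sort_univ Set_sort = range Inr"

definition nat_powerset_struct :: "(nat_sort, nat_fun, nat_rel, nat + nat set) ms_struct" where
  "nat_powerset_struct =
    \<lparr>ms_univ = nat_sort_univ,
     ms_fun_ar = (\<lambda>_. ([Num_sort, Num_sort], Num_sort)),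
     ms_fun_int = (\<lambda>_ bs. Inl (projl (bs ! 0) + projl (bs ! 1))),
     ms_rel_ar = (\<lambda>_. [Num_sort, Set_sort]),
     ms_rel_int = (\<lambda>_ bs. projl (bs ! 0) \<in> projr (bs ! 1))\<rparr>"

end

theory Submission
  imports Defs
begin

text \<open>
  Fix \<open>\<delta> > 0\<close> in the value group. The number \<open>n\<close> is represented by the monomial \<open>t\<close> to the
  \<open>n\<delta>\<close> and a set of numbers by any series \<open>f\<close>, standing for the \<open>n\<close> with \<open>n\<delta>\<close> in the support of
  \<open>f\<close>. All that is needed is to define ``\<open>\<gamma>\<close> is in the support of \<open>f\<close>'' from \<open>f\<close> and
  \<open>t\<close> to the \<open>\<gamma>\<close>, which \<open>\<O>\<close>, \<open>\<MM>\<close> and \<open>\<U>\<close> allow: after division by the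
  monomial, the constant coefficient vanishes iff the series is a sum of an element of \<open>\<U>\<close>
  and an element of the maximal ideal. The set of the representatives of numbers is then the support
  of a single parameter.
\<close>

section \<open>Coefficients and monomials\<close>

text \<open>Only \<open>\<alpha> = \<gamma>\<close> contributes to the convolution, because a
  monomial has a single exponent. Monomials therefore act by shifting exponents, and
  \<open>hahn_monom (- \<gamma>)\<close> undoes the shift.\<close>

lemma coeff_monom_times:
  fixes f :: "('k::comm_ring_1, 'g::linordered_ab_group_add) hahn"
  shows "hahn_coeff (hahn_monom \<gamma> * f) \<beta> = hahn_coeff f (\<beta> - \<gamma>)"
proof -
  have "hahn_coeff (hahn_monom \<gamma> * f) \<beta> =
      (\<Sum>\<alpha>\<in>{\<gamma>}. hahn_coeff (hahn_monom \<gamma>) \<alpha> * hahn_coeff f (\<beta> - \<alpha>))"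
    by (rule coeff_times_superset) (auto simp: hahn_monom.rep_eq split: if_splits)
  then show ?thesis by (simp add: hahn_monom.rep_eq)
qed

lemma monom_times_monom:
  "hahn_monom \<alpha> * hahn_monom \<beta> =
    (hahn_monom (\<alpha> + \<beta>) :: ('k::comm_ring_1, 'g::linordered_ab_group_add) hahn)"
  by (rule hahn_eqI) (auto simp: coeff_monom_times hahn_monom.rep_eq algebra_simps)

lemma hahn_monom_eq_iff:
  "hahn_monom \<alpha> = (hahn_monom \<beta> :: ('k::zero_neq_one, 'g::linorder) hahn) \<longleftrightarrow> \<alpha> = \<beta>"
  by (metis hahn_monom.rep_eq zero_neq_one)

lemma hahn_supp_monom: "hahn_supp (hahn_monom \<gamma> :: ('k::zero_neq_one, 'g::linorder) hahn) = {\<gamma>}"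
  by (auto simp: hahn_supp_def hahn_monom.rep_eq)

text \<open>Well-foundedness passes to subsets. This yields both truncations of a given series and
  series with prescribed support.\<close>

lemma ex_hahn_coeff_eq:
  fixes c :: "'g::linorder \<Rightarrow> 'k::zero"
  assumes "wfp_on A (<)" "\<And>\<gamma>. c \<gamma> \<noteq> 0 \<Longrightarrow> \<gamma> \<in> A"
  shows "\<exists>f. hahn_coeff f = c"
proof -
  have "wfp_on {\<gamma>. c \<gamma> \<noteq> 0} (<)"
    using assms(2) by (auto intro: wfp_on_subset[OF assms(1)])
  then have "hahn_coeff (Abs_hahn c) = c" by (simp add: Abs_hahn_inverse)
  then show ?thesis ..
qed

text \<open>In \<open>u + hahn_monom \<mu> * v\<close> the first summand has only negative exponents
  and the second only exponents from \<open>\<mu>\<close> on, so exponent 0 is missed. Conversely, a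
  series without constant term splits by the sign of its exponents, and well-ordering gives a least
  positive exponent to factor out.\<close>

lemma hahn_coeff_eq_0_iff:
  fixes f :: "('k::comm_ring_1, 'g::linordered_ab_group_add) hahn"
  assumes "0 < (\<delta>::'g)"
  shows "hahn_coeff f \<gamma> = 0 \<longleftrightarrow>
    (\<exists>u v \<mu>. hahn_supp u \<subseteq> {..<0} \<and> hahn_supp v \<subseteq> {0..} \<and> 0 < \<mu> \<and>
      f = hahn_monom \<gamma> * (u + hahn_monom \<mu> * v))" (is "?L \<longleftrightarrow> ?R")
proof
  assume ?R
  then obtain u v \<mu> where *: "hahn_supp u \<subseteq> {..<0}" "hahn_supp v \<subseteq> {0..}" "0 < \<mu>"
    "f = hahn_monom \<gamma> * (u + hahn_monom \<mu> * v)" by blast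
  \<comment> \<open>The coefficient of \<open>f\<close> at \<open>\<gamma>\<close> is that of
    \<open>u\<close> at 0 plus that of \<open>v\<close> at \<open>- \<mu>\<close>.\<close>
  then have "0 \<notin> hahn_supp u" "- \<mu> \<notin> hahn_supp v" by force+
  then show ?L
    by (simp add: *(4) coeff_monom_times plus_hahn.rep_eq hahn_supp_def)
next
  assume L: ?L
  define g where "g = hahn_monom (- \<gamma>) * f"
  have g0: "hahn_coeff g 0 = 0" using L by (simp add: g_def coeff_monom_times)
  have f: "f = hahn_monom \<gamma> * g"
    by (rule hahn_eqI) (simp add: g_def coeff_monom_times)
  have "\<exists>u. hahn_coeff u = (\<lambda>\<beta>. if \<beta> < 0 then hahn_coeff g \<beta> else 0)"
    by (rule ex_hahn_coeff_eq[OF wfp_on_hahn_supp[of g]]) (auto simp: hahn_supp_def split: if_splits)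
  then obtain u where u: "hahn_coeff u = (\<lambda>\<beta>. if \<beta> < 0 then hahn_coeff g \<beta> else 0)" ..
  have "\<exists>w. hahn_coeff w = (\<lambda>\<beta>. if 0 < \<beta> then hahn_coeff g \<beta> else 0)"
    by (rule ex_hahn_coeff_eq[OF wfp_on_hahn_supp[of g]]) (auto simp: hahn_supp_def split: if_splits)
  then obtain w where w: "hahn_coeff w = (\<lambda>\<beta>. if 0 < \<beta> then hahn_coeff g \<beta> else 0)" ..
  have guw: "g = u + w"
    by (rule hahn_eqI) (use g0 in \<open>auto simp: plus_hahn.rep_eq u w not_less_iff_gr_or_eq\<close>)
  obtain \<mu> where \<mu>: "0 < \<mu>" "\<And>\<beta>. \<beta> \<in> hahn_supp w \<Longrightarrow> \<mu> \<le> \<beta>"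
  proof (cases "hahn_supp w = {}")
    case True
    \<comment> \<open>The zero series has no least exponent; any positive \<open>\<mu>\<close>
      serves, and \<open>\<delta>\<close> supplies one.\<close>
    then show ?thesis using that assms by blast
  next
    case False
    then obtain z where "z \<in> hahn_supp w" "\<And>y. y < z \<Longrightarrow> y \<notin> hahn_supp w"
      using wfp_on_hahn_supp[of w] unfolding wfp_on_iff_ex_minimal by blast
    moreover from this(1) have "0 < z" by (auto simp: hahn_supp_def w split: if_splits)
    ultimately show ?thesis using that leI by blast
  qed
  define v where "v = hahn_monom (- \<mu>) * w"
  have "w = hahn_monom \<mu> * v"
    by (rule hahn_eqI) (simp add: v_def coeff_monom_times)
  moreover have "hahn_supp v \<subseteq> {0..}"
    using \<mu>(2) by (fastforce simp: hahn_supp_def v_def coeff_monom_times)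
  moreover have "hahn_supp u \<subseteq> {..<0}"
    by (auto simp: hahn_supp_def u split: if_splits)
  ultimately show ?R using \<mu>(1) f guw by blast
qed

section \<open>Natural multiples in the value group\<close>

primrec nat_scale :: "nat \<Rightarrow> 'g::linordered_ab_group_add \<Rightarrow> 'g" where
  "nat_scale 0 \<delta> = 0"
| "nat_scale (Suc n) \<delta> = nat_scale n \<delta> + \<delta>"

lemma nat_scale_add: "nat_scale (m + n) \<delta> = nat_scale m \<delta> + nat_scale n \<delta>"
  by (induction n) (simp_all add: add.assoc)

lemma strict_mono_nat_scale: "0 < \<delta> \<Longrightarrow> strict_mono (\<lambda>n. nat_scale n \<delta>)"
  by (simp add: strict_mono_Suc_iff)

lemma nat_scale_eq_iff: "0 < \<delta> \<Longrightarrow> nat_scale m \<delta> = nat_scale n \<delta> \<longleftrightarrow> m = n"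
  using strict_mono_eq[OF strict_mono_nat_scale] .

text \<open>A descending sequence in the range pulls back to a descending sequence of natural
  numbers. Hence the multiples of a positive element form an admissible support.\<close>

lemma wfp_on_range_strict_mono:
  fixes s :: "nat \<Rightarrow> 'a::linorder"
  assumes "strict_mono s"
  shows "wfp_on (range s) (<)"
proof (rule wfp_on_if_no_strict_dec)
  fix r :: "nat \<Rightarrow> 'a"
  assume "\<And>n. r n \<in> range s"
  then have "\<forall>n. \<exists>k. r n = s k" by blast
  then obtain k where k: "\<And>n. r n = s (k n)" by metis
  assume dec: "\<And>n. r (Suc n) < r n"
  have "k (Suc n) < k n" for n using dec[of n] assms by (simp add: k strict_mono_less)
  moreover obtain n where "(k (Suc n), k n) \<notin> less_than"
    by (rule wf_no_infinite_down_chainE[OF wf_less_than])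
  ultimately show False by simp
qed

section \<open>The interpreting formulas\<close>

lemma hahn_struct_simps [simp]:
  "univ hahn_struct = UNIV" "fun_ar hahn_struct = hahn_fun_ar"
  "fun_int hahn_struct = hahn_fun_int" "rel_ar hahn_struct = (\<lambda>_. 1)"
  "rel_int hahn_struct = hahn_rel_int"
  by (simp_all add: hahn_struct_def)

text \<open>The quantifiers bind \<open>u\<close> (\<open>Var 2\<close>), \<open>v\<close>
  (\<open>Var 1\<close>) and \<open>hahn_monom \<mu>\<close> (\<open>Var 0\<close>), which shifts
  \<open>i\<close> and \<open>j\<close> by 3. The condition \<open>0 < \<mu>\<close> is expressed by
  a monomial in the valuation ring that differs from 1.\<close>

definition coeff_zero_form :: "nat \<Rightarrow> nat \<Rightarrow> (hahn_fun, hahn_rel) fo_form" where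
  "coeff_zero_form i j = Ex (Ex (Ex
    (And (Rel U_sym [Var 2]) (And (Rel O_sym [Var 1])
    (And (Rel M_sym [Var 0]) (And (Rel O_sym [Var 0]) (And (Neg (Eq (Var 0) (Fn One_sym [])))
    (Eq (Var (j + 3)) (Fn Times_sym [Var (i + 3),
      Fn Plus_sym [Var 2, Fn Times_sym [Var 0, Var 1]]])))))))))"

lemma wf_coeff_zero_form: "wf_form hahn_struct (coeff_zero_form i j)"
  by (simp add: coeff_zero_form_def)

lemma sat_coeff_zero_form:
  fixes e :: "nat \<Rightarrow> ('k::field, 'g::linordered_ab_group_add) hahn"
  assumes "0 < (\<delta>::'g)" "e i = hahn_monom \<gamma>"
  shows "sat hahn_struct e (coeff_zero_form i j) \<longleftrightarrow> hahn_coeff (e j) \<gamma> = 0"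
proof -
  have pos: "(\<exists>m :: ('k, 'g) hahn. m \<in> range hahn_monom \<and> hahn_supp m \<subseteq> {0..} \<and> m \<noteq> 1 \<and> P m)
      \<longleftrightarrow> (\<exists>\<mu>>0. P (hahn_monom \<mu>))" for P
    by (auto simp: hahn_supp_monom one_hahn_def hahn_monom_eq_iff order_less_le)
  have "sat hahn_struct e (coeff_zero_form i j) \<longleftrightarrow>
      (\<exists>u v. hahn_supp u \<subseteq> {..<0} \<and> hahn_supp v \<subseteq> {0..} \<and>
        (\<exists>m. m \<in> range hahn_monom \<and> hahn_supp m \<subseteq> {0..} \<and> m \<noteq> 1 \<and> e j = e i * (u + m * v)))"
    by (simp add: coeff_zero_form_def numeral_3_eq_3 numeral_2_eq_2)
  also have "\<dots> \<longleftrightarrow> hahn_coeff (e j) \<gamma> = 0"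
    unfolding pos assms(2) hahn_coeff_eq_0_iff[OF assms(1)] by blast
  finally show ?thesis .
qed

text \<open>\<open>coeff_zero_form\<close> speaks of a coefficient when variable \<open>i\<close>
  holds a monomial; the first conjunct secures this.\<close>

definition in_supp_form :: "nat \<Rightarrow> nat \<Rightarrow> (hahn_fun, hahn_rel) fo_form" where
  "in_supp_form i j = And (Rel M_sym [Var i]) (Neg (coeff_zero_form i j))"

lemma wf_in_supp_form: "wf_form hahn_struct (in_supp_form i j)"
  by (simp add: in_supp_form_def wf_coeff_zero_form)

lemma sat_in_supp_form:
  fixes e :: "nat \<Rightarrow> ('k::field, 'g::linordered_ab_group_add) hahn"
  assumes "0 < (\<delta>::'g)"
  shows "sat hahn_struct e (in_supp_form i j) \<longleftrightarrow> e i \<in> hahn_monom ` hahn_supp (e j)"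
  by (auto simp: in_supp_form_def hahn_supp_def sat_coeff_zero_form[OF assms])

text \<open>All parameters are set to one series \<open>F\<close>, so outside quantifiers every
  variable from \<open>n\<close> on denotes \<open>F\<close>.\<close>

lemma definable_hahnI:
  fixes F :: "('k::field, 'g::linordered_ab_group_add) hahn"
  assumes "wf_form (hahn_struct :: (_, _, ('k, 'g) hahn) fo_struct) \<phi>"
    and "\<And>xs. xs \<in> X \<Longrightarrow> length xs = n"
    and "\<And>xs. length xs = n \<Longrightarrow>
      xs \<in> X \<longleftrightarrow> sat hahn_struct (\<lambda>i. if i < n then xs ! i else F) \<phi>"
  shows "definable hahn_struct n X"
  unfolding definable_def
  by (rule exI[of _ \<phi>], rule exI[of _ "\<lambda>_. F"]) (use assms in auto)

text \<open>With 1-tuples as codes, a concatenated pair of tuples is a list of two series, so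
  variables 0 and 1 are exactly the two codes.\<close>

lemma coord_preimage_2:
  assumes "\<And>s xs. xs \<in> D s \<Longrightarrow> length xs = 1"
  shows "xs \<in> coord_preimage D \<pi> [s, s'] R \<longleftrightarrow>
    (\<exists>x y. xs = [x, y] \<and> [x] \<in> D s \<and> [y] \<in> D s' \<and> R [\<pi> s [x], \<pi> s' [y]])"
proof
  assume "xs \<in> coord_preimage D \<pi> [s, s'] R"
  then obtain as bs where *: "xs = as @ bs" "as \<in> D s" "bs \<in> D s'" "R [\<pi> s as, \<pi> s' bs]"
    by (auto simp: coord_preimage_def list_all2_Cons1)
  moreover obtain x y where "as = [x]" "bs = [y]"
    using assms[OF *(2)] assms[OF *(3)] by (auto simp: length_Suc_conv)
  ultimately show "\<exists>x y. xs = [x, y] \<and> [x] \<in> D s \<and> [y] \<in> D s' \<and> R [\<pi> s [x], \<pi> s' [y]]"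
    by simp
next
  assume "\<exists>x y. xs = [x, y] \<and> [x] \<in> D s \<and> [y] \<in> D s' \<and> R [\<pi> s [x], \<pi> s' [y]]"
  then obtain x y where "xs = concat [[x], [y]]" "[x] \<in> D s" "[y] \<in> D s'"
    "R [\<pi> s [x], \<pi> s' [y]]" by auto
  then show "xs \<in> coord_preimage D \<pi> [s, s'] R"
    unfolding coord_preimage_def by (intro CollectI exI[of _ "[[x], [y]]"]) simp
qed

lemma coord_preimage_3:
  assumes "\<And>s xs. xs \<in> D s \<Longrightarrow> length xs = 1"
  shows "xs \<in> coord_preimage D \<pi> [s, s', s''] R \<longleftrightarrow>
    (\<exists>x y z. xs = [x, y, z] \<and> [x] \<in> D s \<and> [y] \<in> D s' \<and> [z] \<in> D s'' \<and>
      R [\<pi> s [x], \<pi> s' [y], \<pi> s'' [z]])" (is "_ \<longleftrightarrow> ?R")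
proof
  assume "xs \<in> coord_preimage D \<pi> [s, s', s''] R"
  then obtain as bs cs where *: "xs = as @ bs @ cs" "as \<in> D s" "bs \<in> D s'" "cs \<in> D s''"
    "R [\<pi> s as, \<pi> s' bs, \<pi> s'' cs]"
    by (auto simp: coord_preimage_def list_all2_Cons1)
  moreover obtain x y z where "as = [x]" "bs = [y]" "cs = [z]"
    using assms[OF *(2)] assms[OF *(3)] assms[OF *(4)] by (auto simp: length_Suc_conv)
  ultimately show ?R by simp
next
  assume ?R
  then obtain x y z where "xs = concat [[x], [y], [z]]" "[x] \<in> D s" "[y] \<in> D s'" "[z] \<in> D s''"
    "R [\<pi> s [x], \<pi> s' [y], \<pi> s'' [z]]" by auto
  then show "xs \<in> coord_preimage D \<pi> [s, s', s''] R"
    unfolding coord_preimage_def by (intro CollectI exI[of _ "[[x], [y], [z]]"]) simp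
qed

theorem mainTheorem7:
  assumes nontrivial: "\<exists>\<gamma>::'g::linordered_ab_group_add. \<gamma> \<noteq> 0"
  shows "interprets (hahn_struct :: (hahn_fun, hahn_rel, ('k::field, 'g) hahn) fo_struct)
           nat_powerset_struct"
proof -
  let ?K = "hahn_struct :: (hahn_fun, hahn_rel, ('k, 'g) hahn) fo_struct"
  obtain \<delta> :: 'g where \<delta>: "0 < \<delta>" using nontrivial by (metis neg_0_less_iff_less neqE)
  define t :: "nat \<Rightarrow> ('k, 'g) hahn" where "t n = hahn_monom (nat_scale n \<delta>)" for n
  have t_eq: "t m = t n \<longleftrightarrow> m = n" for m n
    by (simp add: t_def hahn_monom_eq_iff nat_scale_eq_iff[OF \<delta>])
  have t_mult: "t m * t n = t (m + n)" for m n
    by (simp add: t_def monom_times_monom nat_scale_add)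
  have ex_series: "\<exists>f :: ('k, 'g) hahn. hahn_supp f = (\<lambda>n. nat_scale n \<delta>) ` A" for A
  proof -
    have "\<exists>f :: ('k, 'g) hahn.
        hahn_coeff f = (\<lambda>\<gamma>. if \<gamma> \<in> (\<lambda>n. nat_scale n \<delta>) ` A then 1 else 0)"
      by (rule ex_hahn_coeff_eq[OF wfp_on_range_strict_mono[OF strict_mono_nat_scale[OF \<delta>]]])
        (auto split: if_splits)
    then obtain f :: "('k, 'g) hahn"
      where "hahn_coeff f = (\<lambda>\<gamma>. if \<gamma> \<in> (\<lambda>n. nat_scale n \<delta>) ` A then 1 else 0)"
      by blast
    then have "hahn_supp f = (\<lambda>n. nat_scale n \<delta>) ` A" by (auto simp: hahn_supp_def)
    then show ?thesis ..
  qed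
  obtain F :: "('k, 'g) hahn" where F: "hahn_supp F = range (\<lambda>n. nat_scale n \<delta>)"
    using ex_series by blast
  define S where "S f = {n. nat_scale n \<delta> \<in> hahn_supp f}" for f :: "('k, 'g) hahn"
  \<comment> \<open>In the formulas below, the index \<open>j\<close> of \<open>F\<close> is the
    number of coordinates, plus one under a quantifier.\<close>
  have num: "sat ?K e (in_supp_form i j) \<longleftrightarrow> e i \<in> range t" if "e j = F" for e i j
    by (auto simp: sat_in_supp_form[OF \<delta>] that F t_def)
  have zero: "sat ?K e (coeff_zero_form i j) \<longleftrightarrow> n \<notin> S (e j)" if "e i = t n" for e i j n
    using sat_coeff_zero_form[OF \<delta>, of e i "nat_scale n \<delta>" j] that
    by (simp add: t_def S_def hahn_supp_def)
  \<comment> \<open>Every series codes a set: \<open>S\<close> ignores exponents that are not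
    natural multiples of \<open>\<delta>\<close>, so different series can code the same set.\<close>
  define D :: "nat_sort \<Rightarrow> ('k, 'g) hahn list set" where
    "D = case_nat_sort {[t n] |n. True} {[f] |f. True}"
  define \<pi> :: "nat_sort \<Rightarrow> ('k, 'g) hahn list \<Rightarrow> nat + nat set" where
    "\<pi> = case_nat_sort (\<lambda>xs. Inl (inv t (hd xs))) (\<lambda>xs. Inr (S (hd xs)))"
  have inv_t [simp]: "inv t (t n) = n" for n
    by (rule inv_f_f) (simp add: inj_def t_eq)
  have defs: "D Num_sort = {[t n] |n. True}" "D Set_sort = {[f] |f. True}"
    "\<pi> Num_sort xs = Inl (inv t (hd xs))" "\<pi> Set_sort xs = Inr (S (hd xs))" for xs
    by (simp_all add: D_def \<pi>_def)
  have "length xs = 1" if "xs \<in> D s" for s xs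
    using that by (cases s) (auto simp: defs)
  note preimage_2 = coord_preimage_2[of D, OF this] and preimage_3 = coord_preimage_3[of D, OF this]
  have D_num: "definable ?K 1 (D Num_sort)"
    by (rule definable_hahnI[of "in_supp_form 0 1" _ _ F])
      (auto simp: defs wf_in_supp_form num length_Suc_conv)
  have D_set: "definable ?K 1 (D Set_sort)"
    by (rule definable_hahnI[of "Eq (Var 0) (Var 0)"]) (auto simp: defs length_Suc_conv)
  have surj_num: "\<pi> Num_sort ` D Num_sort = range Inl"
    by (force simp: defs)
  have surj_set: "\<pi> Set_sort ` D Set_sort = range Inr"
  proof -
    have "\<exists>f. S f = A" for A
    proof -
      obtain f :: "('k, 'g) hahn" where "hahn_supp f = (\<lambda>n. nat_scale n \<delta>) ` A"
        using ex_series by blast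
      then have "S f = A" by (auto simp: S_def nat_scale_eq_iff[OF \<delta>])
      then show ?thesis ..
    qed
    then have "range S = UNIV" by (metis surjI)
    moreover have "\<pi> Set_sort ` D Set_sort = Inr ` range S" by (force simp: defs)
    ultimately show ?thesis by simp
  qed
  have eq_num: "definable ?K 2 (coord_preimage D \<pi> [Num_sort, Num_sort] (\<lambda>bs. bs ! 0 = bs ! 1))"
    \<comment> \<open>The equation carries membership in \<open>range t\<close> over to the second
      coordinate.\<close>
    by (rule definable_hahnI[of "And (in_supp_form 0 2) (Eq (Var 0) (Var 1))" _ _ F])
      (auto simp: preimage_2 defs wf_in_supp_form num length_Suc_conv numeral_2_eq_2)
  have eq_set: "definable ?K 2 (coord_preimage D \<pi> [Set_sort, Set_sort] (\<lambda>bs. bs ! 0 = bs ! 1))"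
  \<comment> \<open>Equality of codes is too strong here, so equality is extensional: no
    \<open>t n\<close> has its exponent in exactly one of the two supports. Under the binder the
    monomial is variable 0, the two series are 1 and 2, and \<open>F\<close> is 3.\<close>
  proof (rule definable_hahnI[of "And
      (Neg (Ex (And (in_supp_form 0 3) (And (coeff_zero_form 0 1) (Neg (coeff_zero_form 0 2))))))
      (Neg (Ex (And (in_supp_form 0 3) (And (coeff_zero_form 0 2) (Neg (coeff_zero_form 0 1))))))"
      _ _ F], goal_cases)
    case (3 xs)
    then obtain f g where xs: "xs = [f, g]" by (auto simp: length_Suc_conv numeral_2_eq_2)
    \<comment> \<open>Turns quantification over representatives into quantification over numbers,
      where \<open>zero\<close> applies.\<close>
    have ex: "(\<exists>a. a \<in> range t \<and> P a) \<longleftrightarrow> (\<exists>n. P (t n))" for P by blast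
    show ?case
      by (auto simp: preimage_2 defs xs num zero ex numeral_2_eq_2 numeral_3_eq_3)
  qed (auto simp: preimage_2 defs wf_in_supp_form wf_coeff_zero_form)
  have mem: "definable ?K 2 (coord_preimage D \<pi> [Num_sort, Set_sort]
      (\<lambda>bs. projl (bs ! 0) \<in> projr (bs ! 1)))"
    by (rule definable_hahnI[of "And (in_supp_form 0 2) (Neg (coeff_zero_form 0 1))" _ _ F])
      (auto simp: preimage_2 defs wf_in_supp_form wf_coeff_zero_form num zero
        length_Suc_conv numeral_2_eq_2)
  have add: "definable ?K 3 (coord_preimage D \<pi> [Num_sort, Num_sort, Num_sort]
      (\<lambda>bs. Inl (projl (butlast bs ! 0) + projl (butlast bs ! 1)) = last bs))"
    \<comment> \<open>Addition of numbers becomes multiplication of monomials; by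
      \<open>t_mult\<close> the product, hence the third coordinate, is again a
      representative.\<close>
    by (rule definable_hahnI[of "And (in_supp_form 0 3) (And (in_supp_form 1 3)
        (Eq (Fn Times_sym [Var 0, Var 1]) (Var 2)))" _ _ F])
      (auto simp: preimage_3 defs wf_in_supp_form num t_mult
        length_Suc_conv numeral_2_eq_2 numeral_3_eq_3)
  have "is_interpretation ?K nat_powerset_struct (\<lambda>_. 1) D \<pi>"
    unfolding is_interpretation_def
  proof (intro conjI allI impI, goal_cases)
    case (1 s) show ?case using D_num D_set by (cases s) simp_all
  next
    case (2 s) show ?case
      using surj_num surj_set by (cases s) (simp_all add: nat_powerset_struct_def)
  next
    case (3 s) show ?case using eq_num eq_set by (cases s) (simp_all add: numeral_2_eq_2)
  next
    case (4 q) show ?case using mem by (simp add: nat_powerset_struct_def numeral_2_eq_2)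
  next
    case (5 g ss s) then show ?case
      using add by (auto simp: nat_powerset_struct_def numeral_3_eq_3)
  qed
  then show ?thesis unfolding interprets_def by blast
qed

end
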